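(* Let $\lambda>0$ be a fixed real number and let $f\colon(0,1)\to\mathbb{R}$ be a continuous function. Suppose that every line in $\mathbb{R}^2$ which is either vertical or has slope $m$ with $|m|\geq\lambda$ (i.e. $m\ge\lambda$ or $m\le-\lambda$) intersects the graph $\{(x,f(x)) : x\in(0,1)\}$ in at most two points. Then $f$ is locally Lipschitz on $(0,1)$.
   Context: The lines in the hypothesis are all the lines contained in the translates of the closed cone $\{(x,y)\in\mathbb{R}^2 : |y|\ge\lambda|x|\}$ and passing through its vertex, i.e. all parallel shifts of lines in the cone bounded by the lines of slopes $\lambda$ and $-\lambda$ and containing the vertical line. A function is locally Lipschitz on an open interval if every point of the interval has a neighbourhood on which the function is Lipschitz. *)

theory Defs
  imports "HOL-Analysis.Analysis"
begin

definition vertical_line :: "(real \<times> real) set \<Rightarrow> bool" where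
  "vertical_line L \<longleftrightarrow> (\<exists>c. L = {(x, y). x = c})"

definition line_with_slope :: "real \<Rightarrow> (real \<times> real) set \<Rightarrow> bool" where
  "line_with_slope m L \<longleftrightarrow> (\<exists>b. L = {(x, y). y = m * x + b})"

definition graph_on :: "real set \<Rightarrow> (real \<Rightarrow> real) \<Rightarrow> (real \<times> real) set" where
  "graph_on S f = {(x, f x) | x. x \<in> S}"

(* The library's local_lipschitz concerns families of functions depending on a parameter;
   this is the version for a single function. It is meant for open S, where neighbourhoods
   of points of S may be taken inside S. *)
definition locally_lipschitz_on ::
  "'a::metric_space set \<Rightarrow> ('a \<Rightarrow> 'b::metric_space) \<Rightarrow> bool" where
  "locally_lipschitz_on S f \<longleftrightarrow>
    (\<forall>x\<in>S. \<exists>U C. open U \<and> x \<in> U \<and> U \<subseteq> S \<and> C-lipschitz_on U f)"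

end

theory Submission
  imports Defs
begin

text \<open>
  Why the theorem holds: tilting the graph by a steep line turns a steep chord into a zigzag.
  Fix a point \<open>x\<^sub>0\<close> and points \<open>a < x\<^sub>0 < b\<close> of the domain. If \<open>m\<close> is large, the function
  \<open>g x = f x - m * x\<close> satisfies \<open>g a > g x\<^sub>0 > g b\<close>, and by continuity \<open>g p < g a\<close> and
  \<open>g b < g q\<close> whenever \<open>p, q\<close> are close to \<open>x\<^sub>0\<close>. A chord of \<open>f\<close> over \<open>p < q\<close> with slope above \<open>m\<close>
  means \<open>g p < g q\<close>, so that \<open>g\<close> goes down, up and down again over \<open>a < p < q < b\<close>, and the
  three ranges overlap. A common value \<open>c\<close> is then attained three times
  (\<open>zigzag_attains_value_thrice\<close>), that is, the line \<open>y = m * x + c\<close> meets the graph in three points.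
  Hence no chord near \<open>x\<^sub>0\<close> has slope above \<open>m\<close> (\<open>chord_slopes_locally_bounded_above\<close>).
  The reflection \<open>- f\<close> gives a lower bound, and two-sided bounds on the slopes of chords are a
  Lipschitz condition.
\<close>

text \<open>
  The inequalities say exactly that the larger of the two low values \<open>g p\<close>, \<open>g b\<close> lies below
  the smaller of the two high values \<open>g a\<close>, \<open>g q\<close>; every level in between is crossed once on
  each of the three pieces.
\<close>

lemma zigzag_attains_value_thrice:
  fixes g :: "real \<Rightarrow> real"
  assumes cont: "continuous_on {a..b} g"
    and order: "a < p" "p < q" "q < b"
    and zigzag: "g p < g a" "g p < g q" "g b < g a" "g b < g q"
  obtains x y z where "x \<in> {a..b}" "y \<in> {a..b}" "z \<in> {a..b}" "x < y" "y < z"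
    "g x = g y" "g y = g z"
proof -
  have "max (g p) (g b) < min (g a) (g q)"
    using zigzag by simp
  then obtain v where "max (g p) (g b) < v" "v < min (g a) (g q)"
    using dense by blast
  then have v: "g p < v" "g b < v" "v < g a" "v < g q"
    by simp_all
  have cont_on: "continuous_on {s..t} g" if "a \<le> s" "t \<le> b" for s t
    using cont that by (auto intro: continuous_on_subset)
  obtain x where x: "a \<le> x" "x \<le> p" "g x = v"
    using IVT2'[of g p v a] cont_on[of a p] v order by auto
  obtain y where y: "p \<le> y" "y \<le> q" "g y = v"
    using IVT'[of g p v q] cont_on[of p q] v order by auto
  obtain z where z: "q \<le> z" "z \<le> b" "g z = v"
    using IVT2'[of g b v q] cont_on[of q b] v order by auto
  have "x \<noteq> p" "y \<noteq> q"
    using x y v by auto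
  with x y z order show thesis
    by (intro that[of x y z]) auto
qed

text \<open>
  A chord near \<open>x\<^sub>0\<close> that is steeper than \<open>m\<close> would complete a zigzag of \<open>f x - m * x\<close> between two
  fixed points on either side of \<open>x\<^sub>0\<close>, hence three collinear points of the graph. The lemma is
  one-sided, in its hypothesis and in its conclusion: both halves of the Lipschitz condition come
  from it, applied to \<open>f\<close> and to \<open>- f\<close>.
\<close>

lemma chord_slopes_locally_bounded_above:
  fixes f :: "real \<Rightarrow> real"
  assumes "open S" "x\<^sub>0 \<in> S" and cont: "continuous_on S f"
    and no_three: "\<And>m c x y z. \<lbrakk>l \<le> m; x \<in> S; y \<in> S; z \<in> S; x < y; y < z;
        f x = m * x + c; f y = m * y + c; f z = m * z + c\<rbrakk> \<Longrightarrow> False"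
  obtains m e where "0 < e" "ball x\<^sub>0 e \<subseteq> S"
    "\<And>p q. \<lbrakk>p \<in> ball x\<^sub>0 e; q \<in> ball x\<^sub>0 e; p < q\<rbrakk> \<Longrightarrow> f q - f p \<le> m * (q - p)"
proof -
  obtain d where d: "0 < d" "cball x\<^sub>0 d \<subseteq> S"
    using assms(1,2) open_contains_cball by blast
  define a b where "a = x\<^sub>0 - d" and "b = x\<^sub>0 + d"
  have ab: "a < x\<^sub>0" "x\<^sub>0 < b" "{a..b} \<subseteq> S"
    using d by (auto simp: a_def b_def cball_eq_atLeastAtMost)
  \<comment> \<open>Steeper than both chords from \<open>x\<^sub>0\<close> to \<open>a\<close> and \<open>b\<close>, so that \<open>g\<close> drops from \<open>a\<close> to \<open>x\<^sub>0\<close> and from \<open>x\<^sub>0\<close> to \<open>b\<close>.\<close>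
  define m where "m = max l ((\<bar>f a - f x\<^sub>0\<bar> + \<bar>f b - f x\<^sub>0\<bar> + 1) / d)"
  define g where "g = (\<lambda>x. f x - m * x)"
  have "l \<le> m"
    by (simp add: m_def)
  have "(\<bar>f a - f x\<^sub>0\<bar> + \<bar>f b - f x\<^sub>0\<bar> + 1) / d \<le> m"
    by (simp add: m_def)
  then have "\<bar>f a - f x\<^sub>0\<bar> + \<bar>f b - f x\<^sub>0\<bar> + 1 \<le> m * d"
    using d(1) by (simp add: pos_divide_le_eq)
  then have g_ab: "g x\<^sub>0 < g a" "g b < g x\<^sub>0"
    by (auto simp: g_def a_def b_def algebra_simps)
  have cont_g: "continuous_on {a..b} g"
    unfolding g_def by (intro continuous_intros continuous_on_subset[OF cont] ab(3))
  have "isCont g x\<^sub>0"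
    using continuous_on_interior[OF cont_g] ab by simp
  then have "\<forall>\<^sub>F x in nhds x\<^sub>0. g x < g a \<and> g b < g x"
    using g_ab unfolding isCont_def tendsto_at_iff_tendsto_nhds
    by (intro eventually_conj) (auto dest: order_tendstoD)
  moreover have "\<forall>\<^sub>F x in nhds x\<^sub>0. x \<in> {a<..<b}"
    using ab by (intro eventually_nhds_in_open) auto
  ultimately have "\<forall>\<^sub>F x in nhds x\<^sub>0. x \<in> {a<..<b} \<and> g x < g a \<and> g b < g x"
    by eventually_elim simp
  then obtain e where e: "0 < e"
    "\<And>x. x \<in> ball x\<^sub>0 e \<Longrightarrow> a < x \<and> x < b \<and> g x < g a \<and> g b < g x"
    by (auto simp: eventually_nhds_metric dist_commute)
  show thesis
  proof (rule that[OF e(1)])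
    show "ball x\<^sub>0 e \<subseteq> S"
      using e(2) ab(3) by fastforce
    fix p q
    assume pq: "p \<in> ball x\<^sub>0 e" "q \<in> ball x\<^sub>0 e" "p < q"
    show "f q - f p \<le> m * (q - p)"
    proof (rule ccontr)
      assume "\<not> ?thesis"
      then have "g p < g q"
        by (simp add: g_def algebra_simps)
      moreover have "g b < g a"
        using g_ab by simp
      ultimately obtain x y z where xyz: "x \<in> {a..b}" "y \<in> {a..b}" "z \<in> {a..b}"
        "x < y" "y < z" "g x = g y" "g y = g z"
        using zigzag_attains_value_thrice[OF cont_g, of p q] e(2)[OF pq(1)] e(2)[OF pq(2)] pq(3)
        by metis
      show False
        using xyz ab(3) by (intro no_three[OF \<open>l \<le> m\<close>, of x y z "g x"]) (auto simp: g_def)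
    qed
  qed
qed

theorem proposition1:
  fixes l :: real and f :: "real \<Rightarrow> real"
  assumes "l > 0"
    and "continuous_on {0<..<1} f"
    and "\<And>L. vertical_line L \<or> (\<exists>m. \<bar>m\<bar> \<ge> l \<and> line_with_slope m L) \<Longrightarrow>
           finite (L \<inter> graph_on {0<..<1} f) \<and> card (L \<inter> graph_on {0<..<1} f) \<le> 2"
  shows "locally_lipschitz_on {0<..<1} f"
proof -
  let ?S = "{0<..<1::real}"
  have no_three: False
    if m: "l \<le> \<bar>m\<bar>" and S: "x \<in> ?S" "y \<in> ?S" "z \<in> ?S" and less: "x < y" "y < z"
      and line: "f x = m * x + c" "f y = m * y + c" "f z = m * z + c" for m c x y z
  proof -
    define L where "L = {(x, y). y = m * x + c}"
    have "line_with_slope m L"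
      by (auto simp: line_with_slope_def L_def)
    then have L: "finite (L \<inter> graph_on ?S f)" "card (L \<inter> graph_on ?S f) \<le> 2"
      using assms(3) m by blast+
    have "{(x, f x), (y, f y), (z, f z)} \<subseteq> L \<inter> graph_on ?S f"
      using S line by (auto simp: L_def graph_on_def)
    from card_mono[OF L(1) this] L(2) less show False
      by simp
  qed
  have "\<exists>U C. open U \<and> x\<^sub>0 \<in> U \<and> U \<subseteq> ?S \<and> C-lipschitz_on U f" if x0: "x\<^sub>0 \<in> ?S" for x\<^sub>0
  proof -
    obtain m e where up: "0 < e" "ball x\<^sub>0 e \<subseteq> ?S"
      "\<And>p q. \<lbrakk>p \<in> ball x\<^sub>0 e; q \<in> ball x\<^sub>0 e; p < q\<rbrakk> \<Longrightarrow> f q - f p \<le> m * (q - p)"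
    proof (rule chord_slopes_locally_bounded_above[OF open_greaterThanLessThan x0 assms(2)])
      fix m c x y z
      assume "l \<le> m" "x \<in> ?S" "y \<in> ?S" "z \<in> ?S" "x < y" "y < z"
        "f x = m * x + c" "f y = m * y + c" "f z = m * z + c"
      then show False
        using no_three[of m x y z c] by linarith
    qed blast
    have cont: "continuous_on ?S (\<lambda>x. - f x)"
      by (intro continuous_intros assms(2))
    \<comment> \<open>A line of slope \<open>m\<close> through points of the graph of \<open>- f\<close> reflects to one of slope \<open>- m\<close>.\<close>
    obtain m' e' where down: "0 < e'" "ball x\<^sub>0 e' \<subseteq> ?S"
      "\<And>p q. \<lbrakk>p \<in> ball x\<^sub>0 e'; q \<in> ball x\<^sub>0 e'; p < q\<rbrakk> \<Longrightarrow> - f q - - f p \<le> m' * (q - p)"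
    proof (rule chord_slopes_locally_bounded_above[OF open_greaterThanLessThan x0 cont])
      fix m c x y z
      assume "l \<le> m" "x \<in> ?S" "y \<in> ?S" "z \<in> ?S" "x < y" "y < z"
        "- f x = m * x + c" "- f y = m * y + c" "- f z = m * z + c"
      then show False
        using no_three[of "- m" x y z "- c"] by linarith
    qed blast
    define U where "U = ball x\<^sub>0 (min e e')"
    define C where "C = max 0 (max m m')"
    have chord: "dist (f p) (f q) \<le> C * dist p q" if "p \<in> U" "q \<in> U" "p < q" for p q
    proof -
      have "f q - f p \<le> m * (q - p)" "f p - f q \<le> m' * (q - p)"
        using up(3)[of p q] down(3)[of p q] that by (auto simp: U_def)
      moreover have "m * (q - p) \<le> C * (q - p)" "m' * (q - p) \<le> C * (q - p)"
        using that by (intro mult_right_mono; simp add: C_def)+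
      ultimately have "\<bar>f p - f q\<bar> \<le> C * (q - p)"
        by linarith
      then show ?thesis
        using that by (simp add: dist_real_def)
    qed
    have "C-lipschitz_on U f"
    proof (rule lipschitz_onI)
      fix p q
      assume "p \<in> U" "q \<in> U"
      then show "dist (f p) (f q) \<le> C * dist p q"
        using chord[of p q] chord[of q p] by (cases p q rule: linorder_cases) (auto simp: dist_commute)
    qed (simp add: C_def)
    moreover have "open U" "x\<^sub>0 \<in> U" "U \<subseteq> ?S"
      using up(1,2) down(1) by (auto simp: U_def)
    ultimately show ?thesis
      by blast
  qed
  then show ?thesis
    by (simp add: locally_lipschitz_on_def)
qed

end
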